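(* Let $V=\coprod_{n\ge t}V_{(n)}$ (with $t\in\mathbb{Z}$) be a lower truncated $\mathbb{Z}$-graded vertex algebra and let $S$ be a graded subspace of $V$ such that $\{u+C_2(V)\mid u\in S\}$ generates $V/C_2(V)$ as an algebra. Then $V$ is linearly spanned by the vectors $$u^{(1)}_{-n_1}\cdots u^{(r)}_{-n_r}\mathbf{1}$$ for $r\ge 0$, $u^{(1)},\dots,u^{(r)}\in S$, $n_1\ge\cdots\ge n_r\ge 1$. Furthermore, if $S$ is linearly ordered, then $V$ is linearly spanned by those vectors $u^{(1)}_{-n_1}\cdots u^{(r)}_{-n_r}\mathbf{1}$ with $r\ge 0$, $u^{(1)},\dots,u^{(r)}\in S$, $n_1\ge\cdots\ge n_r\ge 1$ that satisfy $u^{(i)}>u^{(i+1)}$ whenever $n_i=n_{i+1}$.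
   Context: Vector spaces are over $\mathbb{C}$. For a vertex algebra $V$ with vacuum $\mathbf{1}$ write $Y(u,x)=\sum_{n\in\mathbb{Z}}u_nx^{-n-1}$. A $\mathbb{Z}$-graded vertex algebra is a vertex algebra with a grading $V=\coprod_{n\in\mathbb{Z}}V_{(n)}$ such that $\mathbf{1}\in V_{(0)}$ and $u_mV_{(n)}\subset V_{(n+k-m-1)}$ for $u\in V_{(k)}$, $k,m,n\in\mathbb{Z}$. It is lower truncated if $V_{(n)}=0$ for $n$ sufficiently small (e.g. any vertex operator algebra). A subspace $S$ is graded if $S=\coprod_n(S\cap V_{(n)})$. "Linearly ordered" means that the set $S$ is equipped with an arbitrary total order. $C_2(V)$ is the linear span of the vectors $u_{-2}v$ for $u,v\in V$; $V/C_2(V)$ is a unital commutative associative algebra with product $(u+C_2(V))(v+C_2(V))=u_{-1}v+C_2(V)$ and identity $\mathbf{1}+C_2(V)$. *)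

theory Defs
  imports Complex_Main "HOL-Library.Groups_Big_Fun"
begin

text \<open>Throughout, \<open>Y u n v\<close> denotes \<open>u\<^sub>n v\<close>, where \<open>u\<^sub>n\<close> is the coefficient of
  \<open>x\<close> to the power \<open>-n-1\<close> in \<open>Y(u,x)\<close>. The vector space \<open>V\<close> is the whole type \<open>'v\<close>,
  with scalar multiplication \<open>scale\<close>.\<close>

text \<open>The axiom \<open>jacobi\<close> is the Jacobi identity in components: the coefficients of
  \<open>x\<^sub>0\<close>, \<open>x\<^sub>1\<close>, \<open>x\<^sub>2\<close> to the powers \<open>-l-1\<close>, \<open>-m-1\<close>, \<open>-n-1\<close> in the delta-function form,
  applied to \<open>w\<close>. Only finitely many summands are nonzero, by \<open>truncation\<close>, so
  \<^const>\<open>Sum_any\<close> (which would be 0 on an infinitely supported family) is the actual sum.\<close>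

locale vertex_algebra = vector_space scale
  for scale :: "complex \<Rightarrow> 'v::ab_group_add \<Rightarrow> 'v" (infixr \<open>*s\<close> 75) +
  fixes Y :: "'v \<Rightarrow> int \<Rightarrow> 'v \<Rightarrow> 'v"
    and vac :: 'v
  assumes linear_left: "Vector_Spaces.linear scale scale (\<lambda>u. Y u n v)"
    and linear_right: "Vector_Spaces.linear scale scale (\<lambda>v. Y u n v)"
    and truncation: "\<exists>N. \<forall>n\<ge>N. Y u n v = 0"
    and vacuum: "Y vac n v = (if n = -1 then v else 0)"
    and creation_regular: "n \<ge> 0 \<Longrightarrow> Y u n vac = 0"
    and creation: "Y u (-1) vac = u"
    and jacobi:
      "(\<Sum>i::nat. (of_int m gchoose i) *s Y (Y u (l + int i) v) (m + n - int i) w) =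
       (\<Sum>i::nat. ((-1) ^ i * (of_int l gchoose i)) *s
          (Y u (m + l - int i) (Y v (n + int i) w)
            - ((-1) powi l) *s Y v (n + l - int i) (Y u (m + int i) w)))"
begin

text \<open>\<open>internal_direct_sum W A\<close>: \<open>W\<close> is the direct sum of the subspaces \<open>A n\<close>, i.e. summation
  is a bijection from the external direct sum (finitely supported families) onto \<open>W\<close>.\<close>

definition internal_direct_sum :: "'v set \<Rightarrow> (int \<Rightarrow> 'v set) \<Rightarrow> bool" where
  "internal_direct_sum W A \<longleftrightarrow>
     (\<forall>n. subspace (A n)) \<and>
     bij_betw Sum_any {f. (\<forall>n. f n \<in> A n) \<and> finite {n. f n \<noteq> 0}} W"

definition C2 :: "'v set" where
  "C2 = span {Y u (-2) v |u v. True}"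

definition C2_coset :: "'v \<Rightarrow> 'v set" where
  "C2_coset u = {u + c |c. c \<in> C2}"

text \<open>The operations of \<open>V/C\<^sub>2(V)\<close>, on cosets. Each union is over cosets that are all equal; see
  the lemmas \<open>C2_coset_add\<close>, \<open>C2_coset_scale\<close> and \<open>C2_coset_mult\<close> below.\<close>

definition C2_quotient :: "'v set set" where
  "C2_quotient = range C2_coset"

definition C2_add :: "'v set \<Rightarrow> 'v set \<Rightarrow> 'v set" where
  "C2_add A B = (\<Union>a\<in>A. \<Union>b\<in>B. C2_coset (a + b))"

definition C2_scale :: "complex \<Rightarrow> 'v set \<Rightarrow> 'v set" where
  "C2_scale c A = (\<Union>a\<in>A. C2_coset (c *s a))"

definition C2_mult :: "'v set \<Rightarrow> 'v set \<Rightarrow> 'v set" where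
  "C2_mult A B = (\<Union>a\<in>A. \<Union>b\<in>B. C2_coset (Y a (-1) b))"

text \<open>Unital subalgebras: \<open>V/C\<^sub>2(V)\<close> is a unital algebra with identity \<open>C2_coset vac\<close>.\<close>

definition C2_subalgebra :: "'v set set \<Rightarrow> bool" where
  "C2_subalgebra B \<longleftrightarrow>
     B \<subseteq> C2_quotient \<and> C2_coset vac \<in> B \<and>
     (\<forall>a\<in>B. \<forall>b\<in>B. C2_add a b \<in> B) \<and>
     (\<forall>c. \<forall>a\<in>B. C2_scale c a \<in> B) \<and>
     (\<forall>a\<in>B. \<forall>b\<in>B. C2_mult a b \<in> B)"

definition C2_generated :: "'v set set \<Rightarrow> 'v set set" where
  "C2_generated X = \<Inter>{B. C2_subalgebra B \<and> X \<subseteq> B}"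

text \<open>\<open>monomial [(u\<^sub>1,n\<^sub>1),\<dots>,(u\<^sub>r,n\<^sub>r)]\<close> applies to the vacuum the modes of \<open>u\<^sub>i\<close> with index
  \<open>-n\<^sub>i\<close>, the last pair acting first.\<close>

definition monomial :: "('v \<times> nat) list \<Rightarrow> 'v" where
  "monomial ps = foldr (\<lambda>(u, n) w. Y u (- int n) w) ps vac"

lemma Y_hom_left: "module_hom scale scale (\<lambda>u. Y u n v)"
  using linear_left by (simp add: linear_iff_module_hom)

lemma Y_hom_right: "module_hom scale scale (\<lambda>v. Y u n v)"
  using linear_right by (simp add: linear_iff_module_hom)

lemmas Y_add_left = module_hom.add[OF Y_hom_left]
lemmas Y_add_right = module_hom.add[OF Y_hom_right]
lemmas Y_scale_left = module_hom.scale[OF Y_hom_left]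
lemmas Y_zero_right = module_hom.zero[OF Y_hom_right]

lemma Sum_any_in_subspace:
  assumes "subspace W" and "\<And>i. f i \<in> W"
  shows "Sum_any f \<in> W"
  unfolding Sum_any.expand_set using assms by (intro subspace_sum) auto

lemma Sum_any_single:
  assumes "\<And>i. i \<noteq> k \<Longrightarrow> f i = 0"
  shows "Sum_any f = f k"
proof -
  have "Sum_any f = sum f {k}"
    by (rule Sum_any.expand_superset) (use assms in auto)
  then show ?thesis by simp
qed

lemma iterate_formula:
  "Y (Y u l v) n w =
     (\<Sum>i::nat. ((-1) ^ i * (of_int l gchoose i)) *s
        (Y u (l - int i) (Y v (n + int i) w)
          - ((-1) powi l) *s Y v (n + l - int i) (Y u (int i) w)))"
proof -
  have "(\<Sum>i::nat. (of_int 0 gchoose i) *s Y (Y u (l + int i) v) (0 + n - int i) w) = Y (Y u l v) n w"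
    by (subst Sum_any_single[where k = 0]) (auto simp: gbinomial_0_left)
  with jacobi[of 0 u l v n w] show ?thesis by simp
qed

lemma commutator_formula:
  "(\<Sum>i::nat. (of_int m gchoose i) *s Y (Y u (int i) v) (m + n - int i) w) =
     Y u m (Y v n w) - Y v n (Y u m w)"
proof -
  have "(\<Sum>i::nat. ((-1) ^ i * (of_int 0 gchoose i)) *s
          (Y u (m + 0 - int i) (Y v (n + int i) w)
            - ((-1) powi 0) *s Y v (n + 0 - int i) (Y u (m + int i) w))) =
        Y u m (Y v n w) - Y v n (Y u m w)"
    by (subst Sum_any_single[where k = 0]) (auto simp: gbinomial_0_left)
  with jacobi[of m u 0 v n w] show ?thesis by simp
qed

lemma subspace_C2: "subspace C2"
  unfolding C2_def by (rule subspace_span)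

lemma Y_derivative:
  assumes "n < 0"
  shows "Y (Y u (-2) vac) n w = of_int (- n) *s Y u (n - 1) w"
proof -
  define k where "k = nat (- 1 - n)"
  have k: "int k = - 1 - n" using assms by (simp add: k_def)
  have coeff: "(-1) ^ k * ((of_int (-2) :: complex) gchoose k) = of_int (- n)"
  proof -
    have "(of_int (-2) :: complex) gchoose k = (-1) ^ k * ((2 + of_nat k - 1) gchoose k)"
      using gbinomial_minus[of "2::complex" k] by simp
    also have "(2 + of_nat k - 1 :: complex) gchoose k = of_nat (Suc k choose k)"
      unfolding binomial_gbinomial by (simp add: algebra_simps)
    also have "of_nat (Suc k choose k) = (of_int (- n) :: complex)"
    proof -
      have "int (Suc k) = - n" using k by simp
      then show ?thesis by (metis binomial_Suc_n of_int_of_nat_eq)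
    qed
    finally show ?thesis by (simp flip: mult.assoc power_add mult_2)
  qed
  show ?thesis
    unfolding iterate_formula[of u "-2" vac n w]
    apply (subst Sum_any_single[where k = k])
    subgoal for i using assms k by (auto simp: vacuum Y_zero_right)
    subgoal using assms k coeff by (auto simp: vacuum)
    done
qed

lemma Y_in_C2: "Y u (- 2 - int k) w \<in> C2"
proof (induction k arbitrary: u)
  case 0
  then show ?case unfolding C2_def by (auto intro!: span_base)
next
  case (Suc k)
  have "of_int (2 + int k) *s Y u (- 2 - int (Suc k)) w \<in> C2"
    using Suc[of "Y u (-2) vac"] Y_derivative[of "- 2 - int k" u w] by (simp add: algebra_simps)
  from subspace_scale[OF subspace_C2 this, of "inverse (of_int (2 + int k))"]
  have "(inverse (of_int (2 + int k)) * of_int (2 + int k)) *s Y u (- 2 - int (Suc k)) w \<in> C2"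
    by simp
  moreover have "(of_int (2 + int k) :: complex) \<noteq> 0"
    by (simp only: of_int_eq_0_iff)
  ultimately show ?case by simp
qed

lemma Y_in_C2':
  assumes "n \<le> -2"
  shows "Y u n w \<in> C2"
  using Y_in_C2[of u "nat (- 2 - n)" w] assms by simp

lemma C2_ideal_right:
  assumes "c \<in> C2"
  shows "Y c (-1) w \<in> C2"
proof -
  have "subspace {c. Y c (-1) w \<in> C2}"
    using module_hom.subspace_vimage[OF Y_hom_left subspace_C2] by (simp add: vimage_def)
  moreover have "Y (Y u (-2) v) (-1) w \<in> C2" for u v
    unfolding iterate_formula[of u "-2" v "-1" w]
    by (intro Sum_any_in_subspace subspace_C2 subspace_scale subspace_diff Y_in_C2') auto
  ultimately have "C2 \<subseteq> {c. Y c (-1) w \<in> C2}"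
    by (subst C2_def, intro span_minimal) auto
  with assms show ?thesis by auto
qed

lemma C2_ideal_left:
  assumes "c \<in> C2"
  shows "Y a (-1) c \<in> C2"
proof -
  have "subspace {c. Y a (-1) c \<in> C2}"
    using module_hom.subspace_vimage[OF Y_hom_right subspace_C2] by (simp add: vimage_def)
  moreover have "Y a (-1) (Y u (-2) v) \<in> C2" for u v
  proof -
    have "Y a (-1) (Y u (-2) v) - Y u (-2) (Y a (-1) v) \<in> C2"
      unfolding commutator_formula[symmetric]
      by (intro Sum_any_in_subspace subspace_C2 subspace_scale Y_in_C2') auto
    from subspace_add[OF subspace_C2 this Y_in_C2'[of "-2" u "Y a (-1) v"]]
    show ?thesis by simp
  qed
  ultimately have "C2 \<subseteq> {c. Y a (-1) c \<in> C2}"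
    by (subst C2_def, intro span_minimal) auto
  with assms show ?thesis by auto
qed

lemma C2_coset_self: "u \<in> C2_coset u"
  unfolding C2_coset_def using subspace_0[OF subspace_C2] by force

lemma C2_coset_absorb:
  assumes "c \<in> C2"
  shows "C2_coset (u + c) = C2_coset u"
proof -
  have "u + c + d = u + (c + d)" "u + d = u + c + (d - c)" for d by (simp_all add: algebra_simps)
  then show ?thesis
    unfolding C2_coset_def
    using subspace_add[OF subspace_C2] subspace_diff[OF subspace_C2] assms by blast
qed

lemma C2_coset_add: "C2_add (C2_coset u) (C2_coset v) = C2_coset (u + v)"
proof -
  have "C2_coset (a + b) = C2_coset (u + v)" if ab: "a \<in> C2_coset u" "b \<in> C2_coset v" for a b
  proof -
    from ab obtain c d where "a = u + c" "b = v + d" "c \<in> C2" "d \<in> C2"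
      unfolding C2_coset_def by auto
    then have "a + b = (u + v) + (c + d)" "c + d \<in> C2"
      using subspace_add[OF subspace_C2] by (simp_all add: algebra_simps)
    then show ?thesis using C2_coset_absorb by simp
  qed
  then show ?thesis unfolding C2_add_def using C2_coset_self by blast
qed

lemma C2_coset_scale: "C2_scale k (C2_coset u) = C2_coset (k *s u)"
proof -
  have "C2_coset (k *s a) = C2_coset (k *s u)" if a: "a \<in> C2_coset u" for a
  proof -
    from a obtain c where "a = u + c" "c \<in> C2" unfolding C2_coset_def by auto
    then have "k *s a = k *s u + k *s c" "k *s c \<in> C2"
      using subspace_scale[OF subspace_C2] by (simp_all add: scale_right_distrib)
    then show ?thesis using C2_coset_absorb by simp
  qed
  then show ?thesis unfolding C2_scale_def using C2_coset_self by blast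
qed

lemma C2_coset_mult: "C2_mult (C2_coset u) (C2_coset v) = C2_coset (Y u (-1) v)"
proof -
  have "C2_coset (Y a (-1) b) = C2_coset (Y u (-1) v)"
    if ab: "a \<in> C2_coset u" "b \<in> C2_coset v" for a b
  proof -
    from ab obtain c d where cd: "a = u + c" "b = v + d" "c \<in> C2" "d \<in> C2"
      unfolding C2_coset_def by auto
    then have "Y a (-1) b = Y u (-1) v + (Y u (-1) d + Y c (-1) b)"
      by (simp add: Y_add_left Y_add_right algebra_simps)
    moreover have "Y u (-1) d + Y c (-1) b \<in> C2"
      using cd by (intro subspace_add[OF subspace_C2] C2_ideal_left C2_ideal_right)
    ultimately show ?thesis using C2_coset_absorb by simp
  qed
  then show ?thesis unfolding C2_mult_def using C2_coset_self by blast
qed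

end

locale Z_graded_vertex_algebra = vertex_algebra scale Y vac
  for scale :: "complex \<Rightarrow> 'v::ab_group_add \<Rightarrow> 'v" (infixr \<open>*s\<close> 75)
    and Y :: "'v \<Rightarrow> int \<Rightarrow> 'v \<Rightarrow> 'v"
    and vac :: 'v +
  fixes V :: "int \<Rightarrow> 'v set"
  assumes grading: "internal_direct_sum UNIV V"
    and vac_degree: "vac \<in> V 0"
    and mode_degree: "u \<in> V k \<Longrightarrow> v \<in> V n \<Longrightarrow> Y u m v \<in> V (n + k - m - 1)"
begin

definition graded_subspace :: "'v set \<Rightarrow> bool" where
  "graded_subspace S \<longleftrightarrow> subspace S \<and> internal_direct_sum S (\<lambda>n. S \<inter> V n)"

end

locale lower_truncated_vertex_algebra = Z_graded_vertex_algebra scale Y vac V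
  for scale :: "complex \<Rightarrow> 'v::ab_group_add \<Rightarrow> 'v" (infixr \<open>*s\<close> 75)
    and Y :: "'v \<Rightarrow> int \<Rightarrow> 'v \<Rightarrow> 'v"
    and vac :: 'v
    and V :: "int \<Rightarrow> 'v set" +
  fixes t :: int
  assumes lower_truncated: "n < t \<Longrightarrow> V n = {0}"

end

theory Submission
  imports Defs "HOL-Library.Multiset"
begin

text \<open>Filter \<open>V\<close> by the spans \<open>filt n\<close> of the vectors
  \<open>u\<^sup>1\<^bsub>-1-k\<^sub>1\<^esub> \<dots> u\<^sup>r\<^bsub>-1-k\<^sub>r\<^esub> v\<close> with \<open>k\<^sub>1 + \<dots> + k\<^sub>r \<ge> n\<close> (Li's filtration). Modulo the
  next step of the filtration, creation modes commute, vectors of \<open>C\<^sub>2(V)\<close> act as zero, and the modes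
  of \<open>x\<^bsub>-1\<^esub> y\<close> are sums of products of modes of \<open>x\<close> and \<open>y\<close>; hence each layer is spanned by
  monomials in homogeneous elements of \<open>S\<close>, arranged in any order. As \<open>S\<close> is a
  subspace, the factors may be rescaled until they are pairwise distinct, which yields the strict
  ordering. Finally, for given \<open>k\<close> and large \<open>n\<close>, \<open>filt n\<close> lies in the span \<open>deep k\<close> of the vectors
  \<open>u\<^bsub>-1-k\<^esub> v\<close>, whose components have degree at least \<open>2t + k\<close>; taking the component of degree \<open>d\<close>
  then removes the error term.\<close>

section \<open>Sorting by a strict order that is total only on the entries of a list\<close>

lemma exists_sorted_wrt_rearrangement:
  assumes "distinct xs"
    and trans: "\<And>x y z. x \<in> set xs \<Longrightarrow> y \<in> set xs \<Longrightarrow> z \<in> set xs \<Longrightarrow> R x y \<Longrightarrow> R y z \<Longrightarrow> R x z"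
    and irrefl: "\<And>x. x \<in> set xs \<Longrightarrow> \<not> R x x"
    and total: "\<And>x y. x \<in> set xs \<Longrightarrow> y \<in> set xs \<Longrightarrow> x \<noteq> y \<Longrightarrow> R x y \<or> R y x"
  shows "\<exists>ys. mset ys = mset xs \<and> sorted_wrt R ys"
proof -
  \<comment> \<open>Counting predecessors maps \<open>R\<close> strictly monotonically into the
    natural numbers, so sorting by this key sorts by \<open>R\<close>: distinct entries are
    comparable, and the wrong direction would contradict the order of the ranks.\<close>
  define rank where "rank x = card {y \<in> set xs. R y x}" for x
  have rank_less: "rank x < rank y" if "x \<in> set xs" "y \<in> set xs" "R x y" for x y
  proof -
    have "{z \<in> set xs. R z x} \<subseteq> {z \<in> set xs. R z y}" using trans that by blast
    moreover have "x \<in> {z \<in> set xs. R z y} - {z \<in> set xs. R z x}" using irrefl that by blast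
    ultimately have "{z \<in> set xs. R z x} \<subset> {z \<in> set xs. R z y}" by blast
    then show ?thesis unfolding rank_def by (intro psubset_card_mono) auto
  qed
  let ?ys = "sort_key rank xs"
  have "R (?ys ! i) (?ys ! j)" if "i < j" "j < length ?ys" for i j
  proof -
    have mem: "?ys ! i \<in> set xs" "?ys ! j \<in> set xs"
      using that nth_mem[of i ?ys] nth_mem[of j ?ys] by (simp_all del: nth_mem)
    have "?ys ! i \<noteq> ?ys ! j" using that assms(1) by (simp add: nth_eq_iff_index_eq)
    moreover have "rank (?ys ! i) \<le> rank (?ys ! j)"
      using that sorted_nth_mono[OF sorted_sort_key[of rank xs], of i j] by simp
    ultimately show ?thesis using total[OF mem] rank_less[OF mem(2,1)] by auto
  qed
  then have "sorted_wrt R ?ys" by (simp add: sorted_wrt_iff_nth_less)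
  then show ?thesis by (intro exI[of _ ?ys]) simp
qed

section \<open>Subspace membership through linearity and the commutator and iterate formulas\<close>

context vertex_algebra
begin

lemma subspace_Y_right_preimage:
  assumes "subspace W"
  shows "subspace {w. Y u n w \<in> W}"
  using module_hom.subspace_vimage[OF Y_hom_right assms] by (simp add: vimage_def)

lemma subspace_Y_left_preimage:
  assumes "subspace W"
  shows "subspace {u. Y u n w \<in> W}"
  using module_hom.subspace_vimage[OF Y_hom_left assms] by (simp add: vimage_def)

lemmas Y_zero_left = module_hom.zero[OF Y_hom_left]

lemma Y_right_span_induct:
  assumes "w \<in> span A" "subspace W" "\<And>a. a \<in> A \<Longrightarrow> Y u n a \<in> W"
  shows "Y u n w \<in> W"
  using span_minimal[of A "{w. Y u n w \<in> W}"] subspace_Y_right_preimage[of W u n] assms by auto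

lemma Y_commutator_mem:
  assumes "subspace W" and "\<And>i::nat. Y (Y u (int i) v) (m + n - int i) w \<in> W"
  shows "Y u m (Y v n w) - Y v n (Y u m w) \<in> W"
  unfolding commutator_formula[symmetric]
  by (intro Sum_any_in_subspace assms subspace_scale[OF assms(1)])

lemma Y_swap_mem:
  assumes "subspace W" "Y v n (Y u m w) \<in> W"
    and "\<And>i::nat. Y (Y u (int i) v) (m + n - int i) w \<in> W"
  shows "Y u m (Y v n w) \<in> W"
  using subspace_add[OF assms(1) Y_commutator_mem[OF assms(1,3)] assms(2)] by simp

lemma Y_iterate_mem:
  assumes "subspace W" "\<And>i::nat. Y u (l - int i) (Y v (n + int i) w) \<in> W"
    and "\<And>i::nat. Y v (n + l - int i) (Y u (int i) w) \<in> W"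
  shows "Y (Y u l v) n w \<in> W"
  unfolding iterate_formula
  by (intro Sum_any_in_subspace subspace_scale[OF assms(1)] subspace_diff[OF assms(1)] assms)

subsection \<open>Li's filtration\<close>

text \<open>The index is shifted by one against \<open>monomial\<close>, so that \<open>k\<close> is
  exactly what a mode contributes to \<open>depth\<close>; \<open>k = 0\<close> is the mode behind
  the product of the quotient by \<open>C2\<close>.\<close>

definition creation_modes :: "('v \<times> nat) list \<Rightarrow> 'v \<Rightarrow> 'v" where
  "creation_modes ps v = foldr (\<lambda>(u, k). Y u (- 1 - int k)) ps v"

definition depth :: "('v \<times> nat) list \<Rightarrow> nat" where
  "depth ps = sum_list (map snd ps)"

lemma creation_modes_simps [simp]:
  "creation_modes [] v = v"
  "creation_modes (p # ps) v = Y (fst p) (- 1 - int (snd p)) (creation_modes ps v)"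
  "creation_modes (ps @ qs) v = creation_modes ps (creation_modes qs v)"
  by (auto simp: creation_modes_def split: prod.splits)

lemma depth_simps [simp]:
  "depth [] = 0" "depth (p # ps) = snd p + depth ps" "depth (ps @ qs) = depth ps + depth qs"
  by (auto simp: depth_def)

text \<open>Integer indices let the bounds below subtract freely; at nonpositive indices the
  filtration is the whole space.\<close>

definition filt :: "int \<Rightarrow> 'v set" where
  "filt n = span {creation_modes ps v |ps v. n \<le> int (depth ps)}"

lemma subspace_filt [simp]: "subspace (filt n)"
  by (simp add: filt_def)

lemma creation_modes_in_filt: "n \<le> int (depth ps) \<Longrightarrow> creation_modes ps v \<in> filt n"
  unfolding filt_def by (auto intro: span_base)

lemma filt_nonpos: "n \<le> 0 \<Longrightarrow> v \<in> filt n"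
  using creation_modes_in_filt[of n "[]" v] by simp

lemma filt_antimono: "v \<in> filt n \<Longrightarrow> m \<le> n \<Longrightarrow> v \<in> filt m"
  unfolding filt_def by (rule subsetD[OF span_mono]) auto

lemma Y_creation_filt:
  assumes "w \<in> filt s" "p < 0" "s' \<le> s - p - 1"
  shows "Y u p w \<in> filt s'"
proof (rule Y_right_span_induct[OF assms(1)[unfolded filt_def]])
  fix a assume "a \<in> {creation_modes ps v |ps v. s \<le> int (depth ps)}"
  then obtain ps v where a: "a = creation_modes ps v" "s \<le> int (depth ps)" by auto
  have "creation_modes ((u, nat (- p - 1)) # ps) v \<in> filt s'"
    by (rule creation_modes_in_filt) (use a assms in auto)
  then show "Y u p a \<in> filt s'" using assms(2) a by simp
qed simp

text \<open>Commute \<open>u_p\<close> past the first factor: the commutator terms are single modes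
  acting on the shorter list, either creating or again annihilating. The loss is \<open>p\<close>,
  one better than the \<open>p + 1\<close> that the rule for creation modes would suggest;
  \<open>Y_product_mem\<close> depends on this gain.\<close>

lemma Y_annihilation_creation_modes:
  assumes "p \<ge> 0" "s \<le> int (depth ps) - p"
  shows "Y u p (creation_modes ps v) \<in> filt s"
  using assms
proof (induction ps arbitrary: u p s)
  case Nil
  then show ?case by (auto intro: filt_nonpos)
next
  case (Cons q ps)
  obtain x k where q: "q = (x, k)" by (cases q)
  have "Y u p (Y x (- 1 - int k) (creation_modes ps v)) \<in> filt s"
  proof (rule Y_swap_mem)
    have "Y u p (creation_modes ps v) \<in> filt (s - int k)"
      by (rule Cons.IH) (use Cons.prems q in auto)
    then show "Y x (- 1 - int k) (Y u p (creation_modes ps v)) \<in> filt s"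
      by (rule Y_creation_filt) auto
  next
    fix i :: nat
    show "Y (Y u (int i) x) (p + (- 1 - int k) - int i) (creation_modes ps v) \<in> filt s"
    proof (cases "p + (- 1 - int k) - int i < 0")
      case True
      have "creation_modes ps v \<in> filt (int (depth ps))" by (rule creation_modes_in_filt) simp
      then show ?thesis by (rule Y_creation_filt) (use True Cons.prems q in auto)
    next
      case False
      then show ?thesis using Cons.prems q by (intro Cons.IH) auto
    qed
  qed simp
  then show ?case by (simp add: q)
qed

lemma Y_annihilation_filt:
  assumes "w \<in> filt s" "p \<ge> 0" "s' \<le> s - p"
  shows "Y u p w \<in> filt s'"
  by (rule Y_right_span_induct[OF assms(1)[unfolded filt_def]])
     (use assms in \<open>auto intro!: Y_annihilation_creation_modes\<close>)

lemma Y_filt: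
  assumes "w \<in> filt s" "s' \<le> s - p - 1"
  shows "Y u p w \<in> filt s'"
  using Y_creation_filt[OF assms(1)] Y_annihilation_filt[OF assms(1), of p s'] assms(2)
  by (cases "p < 0") auto

text \<open>A mode of index \<open>p\<close> shifts the filtration by at least \<open>-p-1\<close>.
  In every term of the iterate formula the two indices add up to \<open>-3-k\<close>, so the shift
  is at least \<open>k + 1\<close> instead of \<open>k\<close>.\<close>

lemma Y_C2_filt:
  assumes "c \<in> C2" "w \<in> filt s"
  shows "Y c (- 1 - int k) w \<in> filt (s + int k + 1)"
proof -
  have "Y (Y u (- 2) v) (- 1 - int k) w \<in> filt (s + int k + 1)" for u v
  proof (rule Y_iterate_mem)
    fix i :: nat
    have "Y v (- 1 - int k + int i) w \<in> filt (s + int k - int i)"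
      by (rule Y_filt[OF assms(2)]) auto
    then show "Y u (- 2 - int i) (Y v (- 1 - int k + int i) w) \<in> filt (s + int k + 1)"
      by (rule Y_filt) auto
    have "Y u (int i) w \<in> filt (s - int i)"
      by (rule Y_annihilation_filt[OF assms(2)]) auto
    then show "Y v (- 1 - int k + - 2 - int i) (Y u (int i) w) \<in> filt (s + int k + 1)"
      by (rule Y_filt) auto
  qed simp
  then have "C2 \<subseteq> {c. Y c (- 1 - int k) w \<in> filt (s + int k + 1)}"
    unfolding C2_def
    by (intro span_minimal subspace_Y_left_preimage subspace_filt) auto
  with assms(1) show ?thesis by auto
qed

text \<open>The two indices in each term add up to \<open>-2-k\<close>, a shift of \<open>k\<close>.
  A term containing an annihilation mode gains one more and falls into
  \<open>filt (s + int k + 1)\<close>, so only the terms with two creation modes remain to be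
  assumed.\<close>

lemma Y_product_mem:
  assumes "subspace W" "filt (s + int k + 1) \<subseteq> W" "w \<in> filt s"
    and "\<And>i j. i + j = k \<Longrightarrow> Y x (- 1 - int i) (Y y (- 1 - int j) w) \<in> W"
  shows "Y (Y x (- 1) y) (- 1 - int k) w \<in> W"
proof (rule Y_iterate_mem)
  fix i :: nat
  show "Y x (- 1 - int i) (Y y (- 1 - int k + int i) w) \<in> W"
  proof (cases "i \<le> k")
    case True
    then show ?thesis using assms(4)[of i "k - i"] by (simp add: of_nat_diff algebra_simps)
  next
    case False
    have "Y y (- 1 - int k + int i) w \<in> filt (s - (- 1 - int k + int i))"
      by (rule Y_annihilation_filt[OF assms(3)]) (use False in auto)
    then have "Y x (- 1 - int i) (Y y (- 1 - int k + int i) w) \<in> filt (s + int k + 1)"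
      by (rule Y_filt) auto
    then show ?thesis using assms(2) by auto
  qed
  have "Y x (int i) w \<in> filt (s - int i)"
    by (rule Y_annihilation_filt[OF assms(3)]) auto
  then have "Y y (- 1 - int k + - 1 - int i) (Y x (int i) w) \<in> filt (s + int k + 1)"
    by (rule Y_filt) auto
  then show "Y y (- 1 - int k + - 1 - int i) (Y x (int i) w) \<in> W" using assms(2) by auto
qed (rule assms)

subsection \<open>Generators of the associated graded space\<close>

text \<open>Including the next filtration step makes this the preimage of a subspace of the
  associated graded space, so no quotient has to be formed.\<close>

definition generated_layer :: "'v set \<Rightarrow> nat \<Rightarrow> 'v set" where
  "generated_layer T s =
     span ({creation_modes ps vac |ps. fst ` set ps \<subseteq> T \<and> depth ps = s} \<union> filt (int s + 1))"

lemma subspace_generated_layer [simp]: "subspace (generated_layer T s)"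
  by (simp add: generated_layer_def)

lemma filt_subset_generated_layer: "filt (int s + 1) \<subseteq> generated_layer T s"
  unfolding generated_layer_def by (auto intro: span_base)

lemma generated_layer_subset_filt: "generated_layer T s \<subseteq> filt (int s)"
  unfolding generated_layer_def
  by (rule span_minimal) (auto intro: creation_modes_in_filt filt_antimono)

text \<open>The cosets of \<open>layer_stable T\<close> form a subalgebra of \<open>V/C\<^sub>2(V)\<close>, which is how the generation
  hypothesis enters.\<close>

definition layer_stable :: "'v set \<Rightarrow> 'v set" where
  "layer_stable T =
     {u. \<forall>k s. \<forall>w\<in>generated_layer T s. Y u (- 1 - int k) w \<in> generated_layer T (k + s)}"

lemma subspace_layer_stable: "subspace (layer_stable T)"
proof -
  have "layer_stable T = (\<Inter>k. \<Inter>s. \<Inter>w\<in>generated_layer T s.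
      {u. Y u (- 1 - int k) w \<in> generated_layer T (k + s)})"
    by (auto simp: layer_stable_def)
  then show ?thesis
    by (auto intro!: subspace_Inter subspace_Y_left_preimage)
qed

lemma C2_subset_layer_stable: "C2 \<subseteq> layer_stable T"
proof -
  have "Y c (- 1 - int k) w \<in> generated_layer T (k + s)"
    if "c \<in> C2" "w \<in> generated_layer T s" for c k s w
    using Y_C2_filt[OF that(1), of w "int s" k] that(2) generated_layer_subset_filt[of T s]
      filt_subset_generated_layer[of "k + s" T]
    by (auto simp: algebra_simps)
  then show ?thesis by (auto simp: layer_stable_def)
qed

lemma subset_layer_stable: "T \<subseteq> layer_stable T"
proof -
  have "Y u (- 1 - int k) w \<in> generated_layer T (k + s)"
    if u: "u \<in> T" and w: "w \<in> generated_layer T s" for u k s w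
  proof (rule Y_right_span_induct[OF w[unfolded generated_layer_def]], goal_cases)
    case (2 a)
    then consider ps where "a = creation_modes ps vac" "fst ` set ps \<subseteq> T" "depth ps = s"
      | "a \<in> filt (int s + 1)" by auto
    then show ?case
    proof cases
      case 1
      then have "Y u (- 1 - int k) a = creation_modes ((u, k) # ps) vac" by simp
      then show ?thesis using 1 u unfolding generated_layer_def
        by (intro span_base UnI1 CollectI exI[of _ "(u, k) # ps"]) auto
    next
      case 2
      then have "Y u (- 1 - int k) a \<in> filt (int (k + s) + 1)" by (rule Y_filt) auto
      then show ?thesis using filt_subset_generated_layer by blast
    qed
  qed simp
  then show ?thesis by (auto simp: layer_stable_def)
qed

lemma vac_layer_stable: "vac \<in> layer_stable T"
  using subspace_0[OF subspace_generated_layer] by (auto simp: layer_stable_def vacuum)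

lemma product_layer_stable:
  assumes "x \<in> layer_stable T" "y \<in> layer_stable T"
  shows "Y x (- 1) y \<in> layer_stable T"
proof -
  have "Y (Y x (- 1) y) (- 1 - int k) w \<in> generated_layer T (k + s)"
    if w: "w \<in> generated_layer T s" for k s w
  proof (rule Y_product_mem[where s = "int s"])
    show "filt (int s + int k + 1) \<subseteq> generated_layer T (k + s)"
      using filt_subset_generated_layer[of "k + s" T] by (simp add: algebra_simps)
    show "w \<in> filt (int s)" using w generated_layer_subset_filt by blast
    fix i j assume ij: "i + j = k"
    have "Y y (- 1 - int j) w \<in> generated_layer T (j + s)"
      using assms(2) w by (auto simp: layer_stable_def)
    then have "Y x (- 1 - int i) (Y y (- 1 - int j) w) \<in> generated_layer T (i + (j + s))"
      using assms(1) by (auto simp: layer_stable_def)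
    then show "Y x (- 1 - int i) (Y y (- 1 - int j) w) \<in> generated_layer T (k + s)"
      using ij by (simp flip: add.assoc)
  qed simp
  then show ?thesis by (auto simp: layer_stable_def)
qed

text \<open>The subalgebra of cosets contains the generators, hence is everything. As
  \<open>layer_stable T\<close> is a subspace containing \<open>C2\<close>, the statement lifts from
  cosets to vectors.\<close>

lemma layer_stable_UNIV:
  assumes gen: "C2_generated (C2_coset ` S) = C2_quotient" and S: "S \<subseteq> span T"
  shows "layer_stable T = UNIV"
proof -
  let ?B = "C2_coset ` layer_stable T"
  have "span T \<subseteq> layer_stable T"
    by (intro span_minimal subset_layer_stable subspace_layer_stable)
  then have "C2_coset ` S \<subseteq> ?B" using S by auto
  moreover have "C2_subalgebra ?B"
    unfolding C2_subalgebra_def C2_quotient_def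
    by (auto simp: C2_coset_add C2_coset_scale C2_coset_mult
        intro!: imageI vac_layer_stable product_layer_stable
          subspace_add[OF subspace_layer_stable] subspace_scale[OF subspace_layer_stable])
  ultimately have sub: "C2_quotient \<subseteq> ?B" using gen unfolding C2_generated_def by blast
  have "u \<in> layer_stable T" for u
  proof -
    obtain v where v: "v \<in> layer_stable T" "C2_coset u = C2_coset v"
      using sub unfolding C2_quotient_def by blast
    then obtain c where "u = v + c" "c \<in> C2"
      using C2_coset_self[of u] unfolding C2_coset_def by auto
    then show ?thesis
      using v C2_subset_layer_stable subspace_add[OF subspace_layer_stable] by blast
  qed
  then show ?thesis by auto
qed

lemma filt_subset_generated_layer_same_depth:
  assumes "layer_stable T = UNIV"
  shows "filt (int n) \<subseteq> generated_layer T n"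
proof -
  have stab: "w \<in> generated_layer T s \<Longrightarrow> Y u (- 1 - int k) w \<in> generated_layer T (k + s)" for u k s w
    using assms by (auto simp: layer_stable_def)
  have "creation_modes [] vac \<in> generated_layer T 0"
    unfolding generated_layer_def
    by (intro span_base UnI1 CollectI exI[of _ "[]"]) auto
  then have vac: "vac \<in> generated_layer T 0" by simp
  have gen: "creation_modes ps v \<in> generated_layer T (depth ps)" for ps v
  proof (induction ps)
    case Nil
    \<comment> \<open>The arbitrary vector \<open>v\<close> is its own mode of index -1 applied to
      the vacuum.\<close>
    show ?case using stab[OF vac, of v 0] by (simp add: creation)
  next
    case (Cons p ps)
    then show ?case using stab[OF Cons.IH, of "fst p" "snd p"] by simp
  qed
  have "creation_modes ps v \<in> generated_layer T n" if "int n \<le> int (depth ps)" for ps v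
  proof (cases "depth ps = n")
    case True
    then show ?thesis using gen[of ps v] by simp
  next
    case False
    then have "creation_modes ps v \<in> filt (int n + 1)"
      using that by (intro creation_modes_in_filt) auto
    then show ?thesis using filt_subset_generated_layer by blast
  qed
  then show ?thesis unfolding filt_def[of "int n"] by (intro span_minimal) auto
qed

subsection \<open>Reordering and rescaling\<close>

lemma creation_modes_hom: "module_hom scale scale (creation_modes ps)"
proof (induction ps)
  case Nil
  then show ?case using linear_id by (simp add: linear_iff_module_hom id_def)
next
  case (Cons p ps)
  have "creation_modes (p # ps) = Y (fst p) (- 1 - int (snd p)) \<circ> creation_modes ps"
    by (auto simp: fun_eq_iff)
  then show ?case using module_hom_compose[OF Cons Y_hom_right] by (simp only:)
qed

text \<open>The commutator consists of single modes of index \<open>-2-k-j-i\<close> with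
  \<open>i >= 0\<close>. Each raises the filtration by at least \<open>k + j + 1\<close>, one more
  than the two modes together.\<close>

lemma Y_swap_creation_filt:
  assumes "w \<in> filt s"
  shows "Y u (- 1 - int k) (Y v (- 1 - int j) w) - Y v (- 1 - int j) (Y u (- 1 - int k) w)
    \<in> filt (s + int k + int j + 1)"
  by (rule Y_commutator_mem) (auto intro!: Y_filt[OF assms])

lemma creation_modes_move_front:
  "creation_modes (as @ p # bs) v - creation_modes (p # as @ bs) v
    \<in> filt (int (depth (p # as @ bs)) + 1)"
proof (induction as)
  case Nil
  then show ?case using subspace_0[OF subspace_filt] by simp
next
  case (Cons a as)
  let ?X = "creation_modes (as @ bs) v" and ?n = "int (depth (p # (a # as) @ bs)) + 1"
  define A where "A = Y (fst a) (- 1 - int (snd a))"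
  define P where "P = Y (fst p) (- 1 - int (snd p))"
  have "A (creation_modes (as @ p # bs) v - creation_modes (p # as @ bs) v) \<in> filt ?n"
    unfolding A_def by (rule Y_filt[OF Cons]) auto
  moreover have "?X \<in> filt (int (depth (as @ bs)))" by (rule creation_modes_in_filt) simp
  then have "A (P ?X) - P (A ?X) \<in> filt ?n"
    unfolding A_def P_def by (rule filt_antimono[OF Y_swap_creation_filt]) auto
  ultimately have "A (creation_modes (as @ p # bs) v - creation_modes (p # as @ bs) v)
      + (A (P ?X) - P (A ?X)) \<in> filt ?n"
    by (rule subspace_add[OF subspace_filt])
  moreover have "A (x - y) = A x - A y" for x y
    unfolding A_def by (rule module_hom.diff[OF Y_hom_right])
  ultimately show ?case by (simp add: A_def P_def)
qed

lemma creation_modes_permute: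
  assumes "mset ps = mset qs"
  shows "creation_modes ps v - creation_modes qs v \<in> filt (int (depth ps) + 1)"
  using assms
proof (induction ps arbitrary: qs)
  case Nil
  then show ?case using subspace_0[OF subspace_filt] by simp
next
  case (Cons p ps)
  then have "p \<in> set qs" by (metis list.set_intros(1) mset_eq_setD)
  then obtain as bs where qs: "qs = as @ p # bs" by (auto simp: in_set_conv_decomp)
  with Cons.prems have m: "mset ps = mset (as @ bs)" by simp
  have d: "depth ps = depth (as @ bs)"
    using m unfolding depth_def by (metis mset_map sum_mset_sum_list)
  have "Y (fst p) (- 1 - int (snd p)) (creation_modes ps v - creation_modes (as @ bs) v)
      \<in> filt (int (depth (p # ps)) + 1)"
    by (rule Y_filt[OF Cons.IH[OF m]]) auto
  moreover have "creation_modes qs v - creation_modes (p # as @ bs) v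
      \<in> filt (int (depth (p # ps)) + 1)"
    using creation_modes_move_front[of as p bs v] d qs by simp
  ultimately have "Y (fst p) (- 1 - int (snd p)) (creation_modes ps v - creation_modes (as @ bs) v)
      - (creation_modes qs v - creation_modes (p # as @ bs) v) \<in> filt (int (depth (p # ps)) + 1)"
    by (rule subspace_diff[OF subspace_filt])
  then show ?case by (simp add: module_hom.diff[OF Y_hom_right])
qed

lemma exists_scale_notin:
  assumes "u \<noteq> 0" "finite B"
  shows "\<exists>c. c \<noteq> 0 \<and> c *s u \<notin> B"
proof (rule ccontr)
  assume "\<not> ?thesis"
  then have "(\<lambda>c. c *s u) ` (UNIV - {0}) \<subseteq> B" by auto
  moreover have "inj_on (\<lambda>c. c *s u) (UNIV - {0})" using assms(1) by (auto simp: inj_on_def)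
  ultimately have "finite (UNIV - {0 :: complex})"
    using assms(2) finite_subset finite_imageD by blast
  then show False by (simp add: infinite_UNIV_char_0)
qed

lemma creation_modes_zero: "0 \<in> fst ` set ps \<Longrightarrow> creation_modes ps v = 0"
  by (induction ps) (force simp: Y_zero_left Y_zero_right)+

text \<open>A strictly sorted list cannot repeat a pair. A nonzero vector has infinitely many
  nonzero multiples, so each factor can avoid the finitely many factors after it, and the monomial
  changes only by a nonzero scalar.\<close>

lemma exists_distinct_rescaling:
  assumes "0 \<notin> fst ` set ps" "\<And>c u. c \<noteq> 0 \<Longrightarrow> u \<in> T \<Longrightarrow> c *s u \<in> T" "fst ` set ps \<subseteq> T"
  shows "\<exists>qs c. c \<noteq> 0 \<and> distinct qs \<and> fst ` set qs \<subseteq> T \<and> depth qs = depth ps \<and>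
    creation_modes qs v = c *s creation_modes ps v"
  using assms
proof (induction ps)
  case Nil
  then show ?case by (intro exI[of _ "[]"] exI[of _ 1]) auto
next
  case (Cons p ps)
  then obtain qs c where qs: "c \<noteq> 0" "distinct qs" "fst ` set qs \<subseteq> T" "depth qs = depth ps"
    "creation_modes qs v = c *s creation_modes ps v"
    by (metis (no_types, lifting) image_insert insert_iff insert_subset list.simps(15))
  obtain b where b: "b \<noteq> 0" "b *s fst p \<notin> fst ` set qs"
    using exists_scale_notin[of "fst p" "fst ` set qs"] Cons.prems by auto
  then have "(b *s fst p, snd p) \<notin> set qs" by force
  with qs b Cons.prems show ?case
    by (intro exI[of _ "(b *s fst p, snd p) # qs"] exI[of _ "b * c"])
       (auto simp: Y_scale_left module_hom.scale[OF Y_hom_right])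
qed

text \<open>Monomials with a zero factor vanish. Any other is rescaled to a distinct list and
  sorted, which costs an element of \<open>filt (int s + 1)\<close>; then the scalar is divided
  out.\<close>

lemma ordered_modes_span:
  assumes trans: "\<And>p q r. fst p \<in> T \<Longrightarrow> fst q \<in> T \<Longrightarrow> fst r \<in> T \<Longrightarrow> R p q \<Longrightarrow> R q r \<Longrightarrow> R p r"
    and irrefl: "\<And>p. \<not> R p p"
    and total: "\<And>p q. fst p \<in> T \<Longrightarrow> fst q \<in> T \<Longrightarrow> p \<noteq> q \<Longrightarrow> R p q \<or> R q p"
    and scale_closed: "\<And>c u. c \<noteq> 0 \<Longrightarrow> u \<in> T \<Longrightarrow> c *s u \<in> T"
    and M: "M = {creation_modes ps vac |ps. fst ` set ps \<subseteq> T \<and> sorted_wrt R ps}"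
  shows "generated_layer T s \<subseteq> span (M \<union> filt (int s + 1))"
proof -
  let ?W = "span (M \<union> filt (int s + 1))"
  have "creation_modes ps vac \<in> ?W" if ps: "fst ` set ps \<subseteq> T" "depth ps = s" for ps
  proof (cases "0 \<in> fst ` set ps")
    case True
    then show ?thesis by (simp add: creation_modes_zero span_zero)
  next
    case False
    then obtain qs c where qs: "c \<noteq> 0" "distinct qs" "fst ` set qs \<subseteq> T" "depth qs = depth ps"
      "creation_modes qs vac = c *s creation_modes ps vac"
      using exists_distinct_rescaling[OF False scale_closed ps(1)] by blast
    have "\<exists>rs. mset rs = mset qs \<and> sorted_wrt R rs"
    proof (rule exists_sorted_wrt_rearrangement[OF qs(2)])
      have mem: "fst x \<in> T" if "x \<in> set qs" for x using that qs(3) by auto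
      show "R x z" if "x \<in> set qs" "y \<in> set qs" "z \<in> set qs" "R x y" "R y z" for x y z
        using trans[OF mem mem mem] that by blast
      show "R x y \<or> R y x" if "x \<in> set qs" "y \<in> set qs" "x \<noteq> y" for x y
        using total[OF mem mem] that by blast
    qed (rule irrefl)
    then obtain rs where rs: "mset rs = mset qs" "sorted_wrt R rs" by blast
    have "set rs = set qs" using rs(1) by (rule mset_eq_setD)
    then have "creation_modes rs vac \<in> ?W"
      using rs(2) qs(3) M by (intro span_base) auto
    moreover have "creation_modes qs vac - creation_modes rs vac \<in> ?W"
      using creation_modes_permute[of qs rs vac] rs(1) qs(4) ps(2) by (intro span_base) auto
    ultimately have "creation_modes rs vac + (creation_modes qs vac - creation_modes rs vac) \<in> ?W"
      by (rule span_add)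
    then have "creation_modes qs vac \<in> ?W" by simp
    from span_scale[OF this, of "inverse c"] show ?thesis by (simp only: qs(5)) (simp add: qs(1))
  qed
  then show ?thesis
    unfolding generated_layer_def
    by (intro span_minimal) (auto intro: span_base)
qed

lemma span_Un_filt_UNIV:
  assumes "\<And>n. filt (int n) \<subseteq> span (M \<union> filt (int n + 1))"
  shows "span (M \<union> filt (int n)) = UNIV"
proof (induction n)
  case 0
  then show ?case using filt_nonpos[of 0] by (auto intro: span_base)
next
  case (Suc n)
  have "span (M \<union> filt (int n)) \<subseteq> span (M \<union> filt (int n + 1))"
    using assms by (intro span_minimal) (auto intro: span_base)
  then show ?case using Suc by (auto simp: add.commute)
qed

subsection \<open>Separation of the filtration\<close>

text \<open>This is the space usually called \<open>C_{k+1}(V)\<close>; in particular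
  \<open>deep 1\<close> is \<open>C2\<close>.\<close>

definition deep :: "nat \<Rightarrow> 'v set" where
  "deep k = span {Y u (- 1 - int k) v |u v. True}"

lemma subspace_deep [simp]: "subspace (deep k)"
  by (simp add: deep_def)

text \<open>For \<open>n < 0\<close>, \<open>Y_derivative\<close> makes \<open>u_{n-1}\<close> a
  nonzero multiple of the mode of index \<open>n\<close> of another vector, so the index can be
  raised step by step.\<close>

lemma Y_deep_add: "Y u (- 1 - int (k + i)) v \<in> deep k"
proof (induction i arbitrary: u)
  case 0
  then show ?case unfolding deep_def by (auto intro: span_base)
next
  case (Suc i)
  let ?c = "of_int (1 + int (k + i)) :: complex"
  have "?c *s Y u (- 1 - int (k + Suc i)) v \<in> deep k"
    using Suc[of "Y u (-2) vac"] Y_derivative[of "- 1 - int (k + i)" u v]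
    by (simp add: algebra_simps)
  from subspace_scale[OF subspace_deep this, of "inverse ?c"]
  have "(inverse ?c * ?c) *s Y u (- 1 - int (k + Suc i)) v \<in> deep k" by simp
  moreover have "?c \<noteq> 0" by (simp only: of_int_eq_0_iff)
  ultimately show ?case by simp
qed

lemma Y_deep: "p \<le> - 1 - int k \<Longrightarrow> Y u p v \<in> deep k"
  using Y_deep_add[of u k "nat (- 1 - int k - p)" v] by simp

text \<open>After swapping, the mode of index \<open>-1-k\<close> is outermost, and the commutator
  terms have index at most \<open>-2-k\<close>.\<close>

lemma Y_creation_deep:
  assumes "w \<in> deep k"
  shows "Y u (- 1 - int j) w \<in> deep k"
proof (rule Y_right_span_induct[OF assms[unfolded deep_def]])
  fix a assume "a \<in> {Y u (- 1 - int k) v |u v. True}"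
  then obtain x v where a: "a = Y x (- 1 - int k) v" by auto
  show "Y u (- 1 - int j) a \<in> deep k"
    unfolding a by (rule Y_swap_mem) (auto intro: Y_deep)
qed simp

lemma creation_modes_deep: "w \<in> deep k \<Longrightarrow> creation_modes ps w \<in> deep k"
  by (induction ps) (auto intro: Y_creation_deep)

text \<open>The product is the summand \<open>i = k\<close> of the iterate formula for \<open>(u\<^bsub>-1\<^esub> v)\<^bsub>-1-2k\<^esub> w\<close>; the
  left-hand side and all other summands lie in \<open>deep (k + 1)\<close>.\<close>

lemma Y_Y_deep_Suc:
  assumes "k \<ge> 1"
  shows "Y u (- 1 - int k) (Y v (- 1 - int k) w) \<in> deep (Suc k)"
proof -
  let ?n = "- 1 - 2 * int k"
  define f where "f i = ((-1) ^ i * (of_int (- 1) gchoose i)) *s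
        (Y u (- 1 - int i) (Y v (?n + int i) w)
          - ((-1) powi (- 1)) *s Y v (?n + - 1 - int i) (Y u (int i) w))" for i :: nat
  have coeff: "(-1) ^ i * (of_int (- 1) gchoose i) = (1 :: complex)" for i
    using gbinomial_minus[of "1 :: complex" i]
    by (simp add: binomial_gbinomial[symmetric] flip: power_add mult_2)
  \<comment> \<open>This is where \<open>k >= 1\<close> enters: it gives
    \<open>-1-2k <= -2-k\<close>.\<close>
  have main: "Sum_any f \<in> deep (Suc k)"
    unfolding f_def iterate_formula[symmetric] by (rule Y_deep) (use assms in auto)
  obtain N1 where N1: "\<forall>n\<ge>N1. Y v n w = 0" using truncation by blast
  obtain N2 where N2: "\<forall>n\<ge>N2. Y u n w = 0" using truncation by blast
  have fin: "finite {i. f i \<noteq> 0}"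
  proof (rule finite_subset)
    show "{i. f i \<noteq> 0} \<subseteq> {..nat (max (N1 - ?n) N2)}"
    proof
      fix i assume i: "i \<in> {i. f i \<noteq> 0}"
      have "f i = 0" if "int i \<ge> max (N1 - ?n) N2"
        unfolding f_def using N1 N2 that by (simp add: Y_zero_right)
      with i show "i \<in> {..nat (max (N1 - ?n) N2)}" by (cases "int i \<ge> max (N1 - ?n) N2") auto
    qed
  qed simp
  \<comment> \<open>In the first product the inner index is at most \<open>-2-k\<close> for
    \<open>i < k\<close>, and the outer one for \<open>i > k\<close>. In the second product the
    outer index always is.\<close>
  have off: "f i \<in> deep (Suc k)" if "i \<noteq> k" for i
  proof -
    have "Y u (- 1 - int i) (Y v (?n + int i) w) \<in> deep (Suc k)"
    proof (cases "i < k")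
      case True
      then show ?thesis by (intro Y_creation_deep Y_deep) auto
    next
      case False
      then show ?thesis using that by (intro Y_deep) auto
    qed
    moreover have "Y v (?n + - 1 - int i) (Y u (int i) w) \<in> deep (Suc k)"
      using assms by (intro Y_deep) auto
    ultimately show ?thesis
      unfolding f_def by (intro subspace_scale subspace_diff subspace_deep)
  qed
  have "Sum_any f = sum f (insert k {i. f i \<noteq> 0})"
    by (rule Sum_any.expand_superset) (use fin in auto)
  also have "\<dots> = f k + sum f ({i. f i \<noteq> 0} - {k})"
    using fin by (simp add: sum.insert_remove)
  finally have "f k = Sum_any f - sum f ({i. f i \<noteq> 0} - {k})" by simp
  also have "\<dots> \<in> deep (Suc k)"
    by (intro subspace_diff[OF subspace_deep] main subspace_sum[OF subspace_deep] off) auto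
  finally have "f k + (((-1) powi (- 1)) *s Y v (?n + - 1 - int k) (Y u (int k) w))
      \<in> deep (Suc k)"
    by (intro subspace_add[OF subspace_deep] subspace_scale[OF subspace_deep] Y_deep) auto
  moreover have "f k = Y u (- 1 - int k) (Y v (?n + int k) w)
      - ((-1) powi (- 1)) *s Y v (?n + - 1 - int k) (Y u (int k) w)"
    by (simp only: f_def coeff scale_one)
  moreover have "?n + int k = - 1 - int k" by simp
  ultimately show ?thesis by (simp only: diff_add_cancel)
qed

lemma Y_deep_Suc:
  assumes "k \<ge> 1" "w \<in> deep k"
  shows "Y u (- 1 - int k) w \<in> deep (Suc k)"
  by (rule Y_right_span_induct[OF assms(2)[unfolded deep_def]])
     (use Y_Y_deep_Suc[OF assms(1)] in auto)

text \<open>Each commutator with the mode of index \<open>-1-k\<close> consists of modes of index at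
  most \<open>-2-k\<close>, and the creation modes to its left preserve
  \<open>deep (Suc k)\<close>.\<close>

lemma creation_modes_swap_deep:
  "creation_modes ps (Y a (- 1 - int k) b) - Y a (- 1 - int k) (creation_modes ps b)
    \<in> deep (Suc k)"
proof (induction ps)
  case Nil
  then show ?case using subspace_0[OF subspace_deep] by simp
next
  case (Cons p ps)
  define P where "P = Y (fst p) (- 1 - int (snd p))"
  define A where "A = Y a (- 1 - int k)"
  have "P (creation_modes ps (A b) - A (creation_modes ps b)) \<in> deep (Suc k)"
    unfolding P_def A_def by (rule Y_creation_deep[OF Cons])
  moreover have "P (A (creation_modes ps b)) - A (P (creation_modes ps b)) \<in> deep (Suc k)"
    unfolding P_def A_def by (rule Y_commutator_mem) (auto intro!: Y_deep)
  ultimately have "P (creation_modes ps (A b) - A (creation_modes ps b))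
      + (P (A (creation_modes ps b)) - A (P (creation_modes ps b))) \<in> deep (Suc k)"
    by (rule subspace_add[OF subspace_deep])
  moreover have "P (x - y) = P x - P y" for x y
    unfolding P_def by (rule module_hom.diff[OF Y_hom_right])
  ultimately show ?case by (simp add: P_def A_def)
qed

lemma creation_modes_mem_deep:
  assumes "(u, j) \<in> set ps" "k \<le> j"
  shows "creation_modes ps v \<in> deep k"
proof -
  from assms(1) obtain as bs where "ps = as @ (u, j) # bs" by (auto simp: in_set_conv_decomp)
  then show ?thesis using assms(2) by (auto intro!: creation_modes_deep Y_deep)
qed

text \<open>Cut after the shortest prefix of depth at least \<open>a\<close>. Its last entry is at
  most \<open>c\<close>, so it overshoots by at most \<open>c\<close> and leaves depth
  \<open>b\<close>.\<close>

lemma depth_split: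
  assumes "a + b + c \<le> depth ps" "\<And>u j. (u, j) \<in> set ps \<Longrightarrow> j \<le> c"
  shows "\<exists>as bs. ps = as @ bs \<and> a \<le> depth as \<and> b \<le> depth bs"
  using assms
proof (induction ps arbitrary: a)
  case Nil
  then show ?case by auto
next
  case (Cons p ps)
  show ?case
  proof (cases "a = 0")
    case True
    then show ?thesis using Cons.prems by (intro exI[of _ "[]"] exI[of _ "p # ps"]) auto
  next
    case a: False
    show ?thesis
    proof (cases "a \<le> snd p")
      case True
      have "snd p \<le> c" using Cons.prems(2)[of "fst p" "snd p"] by simp
      then show ?thesis using True Cons.prems by (intro exI[of _ "[p]"] exI[of _ ps]) auto
    next
      case False
      then have "\<exists>as bs. ps = as @ bs \<and> a - snd p \<le> depth as \<and> b \<le> depth bs"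
        using Cons.prems by (intro Cons.IH) auto
      then obtain as bs where "ps = as @ bs" "a - snd p \<le> depth as" "b \<le> depth bs" by blast
      then show ?thesis by (intro exI[of _ "p # as"] exI[of _ bs]) auto
    qed
  qed
qed

text \<open>If one \<open>k\<^sub>i\<close> is large, that mode moves to the front. Otherwise the product splits into two
  products of large depth: the right one lies in \<open>deep k\<close>, and moving the left one past a mode
  \<open>a\<^bsub>-1-k\<^esub>\<close> gives \<open>a\<^bsub>-1-k\<^esub>\<close> applied to \<open>deep k\<close>, hence an element of \<open>deep (k + 1)\<close>.\<close>

lemma filt_subset_deep: "\<exists>N. filt (int N) \<subseteq> deep (Suc k)"
proof (induction k)
  case 0
  have "creation_modes ps v \<in> deep 1" if "1 \<le> depth ps" for ps v
  proof -
    have "\<exists>p\<in>set ps. snd p \<noteq> 0"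
    proof -
      from that have "depth ps \<noteq> 0" by simp
      then show ?thesis unfolding depth_def sum_list_eq_0_iff by auto
    qed
    then obtain u j where "(u, j) \<in> set ps" "1 \<le> j" by force
    then show ?thesis by (rule creation_modes_mem_deep)
  qed
  then have "filt (int 1) \<subseteq> deep 1" unfolding filt_def by (intro span_minimal) auto
  then show ?case by (intro exI[of _ 1]) simp
next
  case (Suc k)
  then obtain N where N: "filt (int N) \<subseteq> deep (Suc k)" by blast
  \<comment> \<open>Both halves need depth \<open>N\<close>; \<open>Suc k\<close> bounds the
    entries, and so the loss at the cut, once no entry reaches \<open>Suc (Suc k)\<close>.\<close>
  have "creation_modes ps v \<in> deep (Suc (Suc k))" if d: "N + N + Suc k \<le> depth ps" for ps v
  proof (cases "\<exists>u j. (u, j) \<in> set ps \<and> Suc (Suc k) \<le> j")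
    case True
    then show ?thesis using creation_modes_mem_deep by blast
  next
    case False
    then have "\<exists>as bs. ps = as @ bs \<and> N \<le> depth as \<and> N \<le> depth bs"
      by (intro depth_split[OF d]) force
    then obtain as bs where ps: "ps = as @ bs" "N \<le> depth as" "N \<le> depth bs" by blast
    have "creation_modes bs v \<in> deep (Suc k)"
      using N ps creation_modes_in_filt[of "int N" bs] by auto
    moreover have "deep (Suc k) \<subseteq> {x. creation_modes as x \<in> deep (Suc (Suc k))}"
      unfolding deep_def[of "Suc k"]
    proof (rule span_minimal)
      have "creation_modes as (Y a (- 1 - int (Suc k)) b) \<in> deep (Suc (Suc k))" for a b
      proof -
        have "creation_modes as b \<in> deep (Suc k)"
          using N ps creation_modes_in_filt[of "int N" as] by auto
        then have "Y a (- 1 - int (Suc k)) (creation_modes as b) \<in> deep (Suc (Suc k))"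
          by (intro Y_deep_Suc) auto
        from subspace_add[OF subspace_deep creation_modes_swap_deep[of as a "Suc k" b] this]
        show ?thesis by simp
      qed
      then show "{Y u (- 1 - int (Suc k)) v |u v. True}
          \<subseteq> {x. creation_modes as x \<in> deep (Suc (Suc k))}" by blast
      show "subspace {x. creation_modes as x \<in> deep (Suc (Suc k))}"
        using module_hom.subspace_vimage[OF creation_modes_hom subspace_deep]
        by (simp add: vimage_def)
    qed
    ultimately show ?thesis using ps by auto
  qed
  then have "filt (int (N + N + Suc k)) \<subseteq> deep (Suc (Suc k))"
    unfolding filt_def by (intro span_minimal) force+
  then show ?case by blast
qed

end

context Z_graded_vertex_algebra
begin

subsection \<open>Homogeneous components\<close>

definition component :: "'v \<Rightarrow> int \<Rightarrow> 'v" where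
  "component = inv_into {f. (\<forall>n. f n \<in> V n) \<and> finite {n. f n \<noteq> 0}} Sum_any"

lemma subspace_V: "subspace (V n)"
  using grading by (simp add: internal_direct_sum_def)

lemma component_eqI:
  assumes "\<And>n. f n \<in> V n" "finite {n. f n \<noteq> 0}" "Sum_any f = v"
  shows "component v = f"
  using grading assms unfolding component_def internal_direct_sum_def bij_betw_def
  by (intro inv_into_f_eq) auto

lemma component_props:
  shows component_in: "component v n \<in> V n"
    and finite_component: "finite {n. component v n \<noteq> 0}"
    and Sum_any_component: "Sum_any (component v) = v"
proof -
  have "v \<in> Sum_any ` {f. (\<forall>n. f n \<in> V n) \<and> finite {n. f n \<noteq> 0}}"
    using grading unfolding internal_direct_sum_def bij_betw_def by simp
  from inv_into_into[OF this] f_inv_into_f[OF this]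
  show "component v n \<in> V n" "finite {n. component v n \<noteq> 0}" "Sum_any (component v) = v"
    unfolding component_def by auto
qed

lemma component_add: "component (u + v) = (\<lambda>n. component u n + component v n)"
proof (rule component_eqI)
  show "finite {n. component u n + component v n \<noteq> 0}"
    by (rule finite_subset[OF _ finite_UnI[OF finite_component[of u] finite_component[of v]]]) auto
  show "(\<Sum>n. component u n + component v n) = u + v"
    by (simp add: Sum_any.distrib finite_component Sum_any_component)
qed (intro subspace_add[OF subspace_V] component_in)

lemma component_scale: "component (c *s v) = (\<lambda>n. c *s component v n)"
proof (rule component_eqI)
  show "finite {n. c *s component v n \<noteq> 0}"
    by (rule finite_subset[OF _ finite_component[of v]]) auto
  have "(\<Sum>n. c *s component v n) = (\<Sum>n\<in>{n. component v n \<noteq> 0}. c *s component v n)"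
    by (rule Sum_any.expand_superset) (auto simp: finite_component)
  also have "\<dots> = c *s Sum_any (component v)"
    by (simp add: Sum_any.expand_set scale_sum_right)
  finally show "(\<Sum>n. c *s component v n) = c *s v" by (simp add: Sum_any_component)
qed (intro subspace_scale[OF subspace_V] component_in)

lemma subspace_component_preimage:
  assumes "subspace W"
  shows "subspace {v. component v d \<in> W}"
proof (rule subspaceI)
  have "component (0 *s 0) d = 0 *s component 0 d" by (simp only: component_scale)
  then show "0 \<in> {v. component v d \<in> W}" using subspace_0[OF assms] by simp
qed (auto simp: component_add component_scale subspace_add[OF assms] subspace_scale[OF assms])

lemma component_homogeneous:
  assumes "v \<in> V n"
  shows "component v d = (if d = n then v else 0)"
proof -
  have "component v = (\<lambda>d. if d = n then v else 0)"
  proof (rule component_eqI)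
    show "(\<Sum>d. if d = n then v else 0) = v"
      by (subst Sum_any_single[where k = n]) auto
  qed (use assms subspace_0[OF subspace_V] in auto)
  then show ?thesis by simp
qed

lemma span_homogeneous: "span (\<Union>n. V n) = UNIV"
proof -
  have "Sum_any (component v) \<in> span (\<Union>n. V n)" for v
    by (rule Sum_any_in_subspace) (auto intro: span_base component_in)
  then show ?thesis by (auto simp: Sum_any_component)
qed

lemma graded_subspace_span:
  assumes "graded_subspace S"
  shows "S \<subseteq> span (S \<inter> (\<Union>n. V n))"
proof
  fix x assume "x \<in> S"
  then have "x \<in> Sum_any ` {f. (\<forall>n. f n \<in> S \<inter> V n) \<and> finite {n. f n \<noteq> 0}}"
    using assms unfolding graded_subspace_def internal_direct_sum_def bij_betw_def by simp
  then obtain f where "\<And>n. f n \<in> S \<inter> V n" "Sum_any f = x" by blast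
  moreover from this have "Sum_any f \<in> span (S \<inter> (\<Union>n. V n))"
    by (intro Sum_any_in_subspace) (auto intro: span_base)
  ultimately show "x \<in> span (S \<inter> (\<Union>n. V n))" by simp
qed

lemma creation_modes_homogeneous:
  assumes "fst ` set ps \<subseteq> (\<Union>n. V n)"
  shows "\<exists>n. creation_modes ps vac \<in> V n"
  using assms
proof (induction ps)
  case Nil
  then show ?case using vac_degree by auto
next
  case (Cons p ps)
  then obtain k n where "creation_modes ps vac \<in> V n" "fst p \<in> V k" by auto
  from mode_degree[OF this(2,1)] show ?case by auto
qed

end

section \<open>Spanning sets in the lower truncated case\<close>

context lower_truncated_vertex_algebra
begin

lemma component_deep:
  assumes "x \<in> deep k" "d < 2 * t + int k"
  shows "component x d = 0"
proof -
  have sub: "subspace {x. component x d = 0}"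
    using subspace_component_preimage[of "{0}" d] by (simp add: subspace_single_0)
  have *: "component (Y u (- 1 - int k) v) d = 0" if "u \<in> V m" "v \<in> V n" for u v m n
  proof (cases "m < t \<or> n < t")
    case True
    then have "u = 0 \<or> v = 0" using that lower_truncated by auto
    then show ?thesis using subspace_0[OF sub] by (auto simp: Y_zero_left Y_zero_right)
  next
    case False
    then show ?thesis
      using component_homogeneous[OF mode_degree[OF that, of "- 1 - int k"], of d] assms(2) by auto
  qed
  have "component (Y u (- 1 - int k) v) d = 0" if "u \<in> V m" for u v m
  proof -
    have "Y u (- 1 - int k) v \<in> {x. component x d = 0}"
      by (rule Y_right_span_induct[of v "\<Union>n. V n"]) (use * that sub span_homogeneous in auto)
    then show ?thesis by simp
  qed
  then have "span (\<Union>n. V n) \<subseteq> {u. Y u (- 1 - int k) v \<in> {x. component x d = 0}}" for v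
    by (intro span_minimal subspace_Y_left_preimage sub) auto
  then have "deep k \<subseteq> {x. component x d = 0}"
    unfolding deep_def by (intro span_minimal sub) (auto simp: span_homogeneous)
  then show ?thesis using assms(1) by auto
qed

text \<open>Homogeneous factors make every monomial homogeneous, so taking the component of degree
  \<open>d\<close> either keeps it or kills it and hence maps the span of the monomials into
  itself.\<close>

lemma ordered_homogeneous_modes_span:
  assumes S: "graded_subspace S"
    and gen: "C2_generated (C2_coset ` S) = C2_quotient"
    and le: "linear_order_on S le"
  defines "R \<equiv> \<lambda>p q. snd q < snd p \<or> snd p = snd q \<and> (fst q, fst p) \<in> le \<and> fst q \<noteq> fst p"
  shows "span {creation_modes ps vac |ps. fst ` set ps \<subseteq> S \<inter> (\<Union>n. V n) \<and> sorted_wrt R ps} = UNIV"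
proof -
  define T where "T = S \<inter> (\<Union>n. V n)"
  define M where "M = {creation_modes ps vac |ps. fst ` set ps \<subseteq> T \<and> sorted_wrt R ps}"
  have "layer_stable T = UNIV"
    using layer_stable_UNIV[OF gen graded_subspace_span[OF S]] by (simp add: T_def)
  note same_depth = filt_subset_generated_layer_same_depth[OF this]
  from le have le_trans: "trans le" and le_antisym: "antisym le" and le_total: "total_on S le"
    by (auto simp: linear_order_on_def partial_order_on_def preorder_on_def)
  have "generated_layer T s \<subseteq> span (M \<union> filt (int s + 1))" for s
  proof (rule ordered_modes_span[OF _ _ _ _ M_def])
    show "R p r" if "R p q" "R q r" for p q r
      using that le_trans le_antisym unfolding R_def
      by (auto dest: transD antisymD)
    show "R p q \<or> R q p" if "fst p \<in> T" "fst q \<in> T" "p \<noteq> q" for p q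
      using that le_total unfolding R_def T_def total_on_def
      by (cases "snd p = snd q") (auto simp: prod_eq_iff)
    show "c *s u \<in> T" if "u \<in> T" for c u
      using that S subspace_scale subspace_V unfolding T_def graded_subspace_def by blast
  qed (simp add: R_def)
  then have full: "span (M \<union> filt (int n)) = UNIV" for n
    using same_depth by (intro span_Un_filt_UNIV) blast
  have "V d \<subseteq> span M" for d
  proof
    fix v assume v: "v \<in> V d"
    \<comment> \<open>With \<open>k = Suc (nat (d - 2 * t))\<close> one has
      \<open>d < 2 * t + k\<close> also when \<open>d - 2 * t\<close> is negative, so
      \<open>component_deep\<close> applies.\<close>
    obtain N where N: "filt (int N) \<subseteq> deep (Suc (nat (d - 2 * t)))"
      using filt_subset_deep by blast
    have "M \<union> filt (int N) \<subseteq> {x. component x d \<in> span M}"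
    proof safe
      fix x assume x: "x \<in> M"
      then obtain n where "x \<in> V n"
        using creation_modes_homogeneous unfolding M_def T_def by blast
      then show "component x d \<in> span M"
        using x by (simp add: component_homogeneous span_base span_zero)
    next
      fix x assume "x \<in> filt (int N)"
      with N have "x \<in> deep (Suc (nat (d - 2 * t)))" by blast
      then have "component x d = 0" by (rule component_deep) simp
      then show "component x d \<in> span M" by (simp add: span_zero)
    qed
    then have "span (M \<union> filt (int N)) \<subseteq> {x. component x d \<in> span M}"
      by (intro span_minimal subspace_component_preimage subspace_span)
    then have "component v d \<in> span M" using full by auto
    then show "v \<in> span M" using v by (simp add: component_homogeneous)
  qed
  then have "span (\<Union>n. V n) \<subseteq> span M" by (intro span_minimal) auto
  then show ?thesis using span_homogeneous unfolding M_def T_def by auto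
qed

lemma creation_modes_eq_monomial: "creation_modes ps vac = monomial (map (apsnd Suc) ps)"
proof (induction ps)
  case Nil
  then show ?case by (simp add: monomial_def)
next
  case (Cons p ps)
  have "- 1 - int (snd p) = - int (Suc (snd p))" by simp
  with Cons show ?case
    by (simp only: creation_modes_simps monomial_def list.map foldr.simps o_apply apsnd_def
        map_prod_def split_beta id_apply fst_conv snd_conv)
qed

text \<open>This spanning set contains the homogeneous one: factors may be any elements of
  \<open>S\<close>, and strictness is asked only of neighbours.\<close>

lemma ordered_monomials_span:
  assumes "graded_subspace S"
    and "C2_generated (C2_coset ` S) = C2_quotient"
    and "linear_order_on S le"
  shows "span {monomial ps |ps.
     (\<forall>(u, n) \<in> set ps. u \<in> S \<and> n \<ge> 1) \<and> sorted_wrt (\<ge>) (map snd ps) \<and>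
     (\<forall>i. Suc i < length ps \<longrightarrow> snd (ps ! i) = snd (ps ! Suc i) \<longrightarrow>
        (fst (ps ! Suc i), fst (ps ! i)) \<in> le \<and> fst (ps ! Suc i) \<noteq> fst (ps ! i))} = UNIV"
    (is "span ?M = UNIV")
proof -
  define R where
    "R = (\<lambda>p q :: 'v \<times> nat. snd q < snd p \<or> snd p = snd q \<and> (fst q, fst p) \<in> le \<and> fst q \<noteq> fst p)"
  have "creation_modes ps vac \<in> ?M"
    if "fst ` set ps \<subseteq> S \<inter> (\<Union>n. V n)" "sorted_wrt R ps" for ps
  proof (intro CollectI exI[of _ "map (apsnd Suc) ps"] conjI)
    show "creation_modes ps vac = monomial (map (apsnd Suc) ps)"
      by (rule creation_modes_eq_monomial)
    show "\<forall>(u, n) \<in> set (map (apsnd Suc) ps). u \<in> S \<and> n \<ge> 1" using that(1) by auto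
    show "sorted_wrt (\<ge>) (map snd (map (apsnd Suc) ps))"
      using that(2) unfolding sorted_wrt_map by (rule sorted_wrt_mono_rel[rotated]) (auto simp: R_def)
    show "\<forall>i. Suc i < length (map (apsnd Suc) ps) \<longrightarrow>
        snd (map (apsnd Suc) ps ! i) = snd (map (apsnd Suc) ps ! Suc i) \<longrightarrow>
        (fst (map (apsnd Suc) ps ! Suc i), fst (map (apsnd Suc) ps ! i)) \<in> le \<and>
        fst (map (apsnd Suc) ps ! Suc i) \<noteq> fst (map (apsnd Suc) ps ! i)"
    proof safe
      fix i assume i: "Suc i < length (map (apsnd Suc) ps)"
        "snd (map (apsnd Suc) ps ! i) = snd (map (apsnd Suc) ps ! Suc i)"
      then have "R (ps ! i) (ps ! Suc i)" using that(2) by (simp add: sorted_wrt_iff_nth_less)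
      then show "(fst (map (apsnd Suc) ps ! Suc i), fst (map (apsnd Suc) ps ! i)) \<in> le"
        and "fst (map (apsnd Suc) ps ! Suc i) = fst (map (apsnd Suc) ps ! i) \<Longrightarrow> False"
        using i by (auto simp: R_def)
    qed
  qed
  then have "span {creation_modes ps vac |ps. fst ` set ps \<subseteq> S \<inter> (\<Union>n. V n) \<and> sorted_wrt R ps}
      \<subseteq> span ?M"
    by (intro span_mono) blast
  then show ?thesis
    using ordered_homogeneous_modes_span[OF assms] unfolding R_def by blast
qed

end

theorem theorem4p8:
  fixes scale :: "complex \<Rightarrow> 'v::ab_group_add \<Rightarrow> 'v"
    and Y :: "'v \<Rightarrow> int \<Rightarrow> 'v \<Rightarrow> 'v"
    and vac :: 'v
    and V :: "int \<Rightarrow> 'v set"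
    and t :: int
    and S :: "'v set"
  assumes "lower_truncated_vertex_algebra scale Y vac V t"
    and "Z_graded_vertex_algebra.graded_subspace scale V S"
    and "vertex_algebra.C2_generated scale Y vac (vertex_algebra.C2_coset scale Y ` S)
           = vertex_algebra.C2_quotient scale Y"
  shows "module.span scale
           {vertex_algebra.monomial Y vac ps |ps.
              (\<forall>(u, n) \<in> set ps. u \<in> S \<and> n \<ge> 1) \<and> sorted_wrt (\<ge>) (map snd ps)} = UNIV \<and>
         (\<forall>le. linear_order_on S le \<longrightarrow>
           module.span scale
             {vertex_algebra.monomial Y vac ps |ps.
                (\<forall>(u, n) \<in> set ps. u \<in> S \<and> n \<ge> 1) \<and> sorted_wrt (\<ge>) (map snd ps) \<and>
                (\<forall>i. Suc i < length ps \<longrightarrow> snd (ps ! i) = snd (ps ! Suc i) \<longrightarrow>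
                   (fst (ps ! Suc i), fst (ps ! i)) \<in> le \<and> fst (ps ! Suc i) \<noteq> fst (ps ! i))} = UNIV)"
proof -
  interpret lower_truncated_vertex_algebra scale Y vac V t by (rule assms(1))
  note ordered = ordered_monomials_span[OF assms(2,3)]
  \<comment> \<open>The unordered claim follows from the ordered one for any linear order on
    \<open>S\<close>; the well-ordering theorem supplies one.\<close>
  obtain le where "well_order_on S le" using well_order_on by blast
  then have "linear_order_on S le" by (simp add: well_order_on_def)
  have "UNIV \<subseteq> span {monomial ps |ps.
      (\<forall>(u, n) \<in> set ps. u \<in> S \<and> n \<ge> 1) \<and> sorted_wrt (\<ge>) (map snd ps)}"
    by (subst ordered[OF \<open>linear_order_on S le\<close>, symmetric]) (rule span_mono, blast)
  with ordered show ?thesis by (intro conjI allI impI) auto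
qed

end
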